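(* Let $X$ be a separable Banach space and let $\{f_n\}\subset X^*$ be a bounded sequence that is almost overtotal on $X$. Then $\{f_n\}$ is relatively norm-compact, i.e. the norm closure of the set $\{f_n : n\in\mathbb N\}$ is compact in $X^*$.
   Context: A sequence $\{f_n\}$ in the dual $X^*$ of a Banach space $X$ is called almost overtotal on $X$ if, for every subsequence $\{f_{n_k}\}$, the annihilator $\{x\in X : f_{n_k}(x)=0 \text{ for all } k\}$ is finite-dimensional. *)

theory Defs
  imports "HOL-Analysis.Analysis"
begin

text \<open>
  Banach spaces over the real or the complex field, treated uniformly. The scalars form a type
  \<open>'k\<close> of class \<open>real_normed_field\<close> and \<open>heine_borel\<close>; \<open>real\<close> and \<open>complex\<close> are
  the instances (up to isomorphism the only ones, by Mazur's theorem). The type class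
  \<open>banach\<close> supplies the underlying real Banach space, and \<open>scale\<close> is the multiplication by
  scalars from \<open>'k\<close>, which extends \<open>scaleR\<close> and for which the norm is homogeneous.
\<close>

locale banach_over = vector_space scale
  for scale :: "'k :: {real_normed_field, heine_borel} \<Rightarrow> 'a :: banach \<Rightarrow> 'a" +
  assumes scale_of_real: "scale (of_real r) x = r *\<^sub>R x"
    and norm_scale: "norm (scale c x) = norm c * norm x"
begin

text \<open>
  The dual: the bounded functionals that are linear over \<open>'k\<close>. The ambient type requires linearity
  over the reals only; its norm is the usual operator norm.
\<close>

definition dual :: "('a \<Rightarrow>\<^sub>L 'k) set" where
  "dual = {f. \<forall>c x. blinfun_apply f (scale c x) = c * blinfun_apply f x}"

definition finite_dimensional :: "'a set \<Rightarrow> bool" where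
  "finite_dimensional S \<longleftrightarrow> (\<exists>B. finite B \<and> span B = S)"

definition almost_overtotal :: "(nat \<Rightarrow> 'a \<Rightarrow>\<^sub>L 'k) \<Rightarrow> bool" where
  "almost_overtotal f \<longleftrightarrow>
    (\<forall>r :: nat \<Rightarrow> nat. strict_mono r \<longrightarrow> finite_dimensional {x. \<forall>k. blinfun_apply (f (r k)) x = 0})"

text \<open>
  Since the dual is closed in the ambient type, the closure of a subset of the dual
  is the same in both.
\<close>

lemma closed_dual: "closed dual"
proof -
  have "dual = (\<Inter>c. \<Inter>x. {f. blinfun_apply f (scale c x) = c * blinfun_apply f x})"
    by (auto simp: dual_def)
  then show ?thesis
    by (auto intro!: closed_INT closed_Collect_eq continuous_intros)
qed

end

lemma banach_over_real: "banach_over ((*\<^sub>R) :: real \<Rightarrow> 'a :: banach \<Rightarrow> 'a)"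
  by unfold_locales (auto simp: algebra_simps)

lemma dual_real: "banach_over.dual ((*\<^sub>R) :: real \<Rightarrow> 'a :: banach \<Rightarrow> 'a) = UNIV"
  by (auto simp: banach_over.dual_def[OF banach_over_real] blinfun.scaleR_right)

lemma banach_over_complex: "banach_over ((*) :: complex \<Rightarrow> complex \<Rightarrow> complex)"
  by unfold_locales (auto simp: algebra_simps scaleR_conv_of_real norm_mult)

end

theory Submission
  imports Defs "HOL-Complex_Analysis.Great_Picard"
begin

text \<open>
  If the sequence is not relatively compact, some subsequence converges pointwise to a functional
  \<open>h\<close> (diagonal argument on a countable dense set) while staying at norm distance at least \<open>\<delta>\<close> from
  \<open>h\<close>. The differences \<open>g\<close> form a pointwise null sequence bounded away from \<open>0\<close>, from which a
  gliding hump extracts functionals \<open>\<phi> i\<close> and vectors \<open>x i\<close> such that the matrix \<open>\<phi> i (x j)\<close> is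
  lower unitriangular with rapidly decreasing entries below the diagonal. Subtracting from \<open>x l\<close>,
  for odd \<open>l\<close>, a convergent series of the \<open>x i\<close> with even \<open>i > l\<close> makes it vanish under all
  \<open>\<phi> i\<close> with even \<open>i\<close>, and the odd functionals witness that the resulting vectors are
  linearly independent. So the even differences have an infinite-dimensional annihilator, whose
  intersection with the kernel of \<open>h\<close> is still infinite-dimensional.
\<close>

section \<open>Pointwise limits and sequential compactness of closures\<close>

text \<open>Sequential Banach-Alaoglu: diagonal extraction yields convergence on a countable dense
  set, and the common Lipschitz constant \<open>K\<close> carries the Cauchy property from there to
  every point. The same \<open>K\<close> bounds the limit.\<close>

lemma pointwise_convergent_subsequence:
  fixes f :: "nat \<Rightarrow> 'a::real_normed_vector \<Rightarrow>\<^sub>L 'b::{real_normed_vector, heine_borel}"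
  assumes sep: "separable_space (euclidean :: 'a topology)" and bdd: "bounded (range f)"
  obtains r h where "strict_mono (r :: nat \<Rightarrow> nat)"
    "\<And>x. (\<lambda>n. blinfun_apply (f (r n)) x) \<longlonglongrightarrow> blinfun_apply h x"
proof -
  obtain K where K: "K > 0" "\<And>n. norm (f n) \<le> K"
    using bdd unfolding bounded_pos by auto
  have Kx: "norm (blinfun_apply (f n) x) \<le> K * norm x" for n x
    using norm_blinfun[of "f n" x] K(2)[of n]
    by (meson mult_right_mono norm_ge_zero order_trans)
  obtain C :: "'a set" where C: "countable C" "closure C = UNIV"
    using sep unfolding separable_space_def by auto
  \<comment> \<open>The diagonal lemma asks for one bound valid at all points of \<open>C\<close>,
    so the values are scaled by \<open>1 + norm x\<close>, which is positive even at the origin. The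
    scaling is undone in \<open>conv_C\<close>.\<close>
  have "norm (blinfun_apply (f n) x /\<^sub>R (1 + norm x)) \<le> K" for n x
  proof -
    have "norm (blinfun_apply (f n) x) \<le> K * (1 + norm x)"
      using Kx[of n x] K(1) by (simp add: algebra_simps)
    moreover have "1 + norm x > 0" by (simp add: add_pos_nonneg)
    ultimately show ?thesis by (simp add: field_simps)
  qed
  with function_convergent_subsequence[of C "\<lambda>n x. blinfun_apply (f n) x /\<^sub>R (1 + norm x)" K] C(1)
  obtain r where r: "strict_mono (r :: nat \<Rightarrow> nat)"
    and conv: "\<And>x. x \<in> C \<Longrightarrow> \<exists>l. (\<lambda>n. blinfun_apply (f (r n)) x /\<^sub>R (1 + norm x)) \<longlonglongrightarrow> l"
    by metis
  have conv_C: "Cauchy (\<lambda>n. blinfun_apply (f (r n)) x)" if x: "x \<in> C" for x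
  proof -
    from conv[OF x] obtain l where l: "(\<lambda>n. blinfun_apply (f (r n)) x /\<^sub>R (1 + norm x)) \<longlonglongrightarrow> l"
      by blast
    have "1 + norm x \<noteq> 0" by (smt (verit) norm_ge_zero)
    with tendsto_scaleR[OF tendsto_const[of "1 + norm x"] l]
    have "(\<lambda>n. blinfun_apply (f (r n)) x) \<longlonglongrightarrow> (1 + norm x) *\<^sub>R l" by simp
    then show ?thesis by (rule LIMSEQ_imp_Cauchy)
  qed
  have "Cauchy (\<lambda>n. blinfun_apply (f (r n)) x)" for x
  proof (rule metric_CauchyI)
    fix e :: real assume e: "e > 0"
    \<comment> \<open>Budget: moving from \<open>x\<close> to \<open>y\<close> and back costs less
      than \<open>e / 4\<close> each time, which leaves \<open>e / 2\<close> for the Cauchy estimate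
      at \<open>y\<close>.\<close>
    obtain y where y: "y \<in> C" "dist y x < e / (4 * K)"
      using C(2) e K(1) closure_approachable[of x C]
      by (metis UNIV_I divide_pos_pos mult_pos_pos zero_less_numeral)
    have near: "dist (blinfun_apply (f n) x) (blinfun_apply (f n) y) < e / 4" for n
    proof -
      have "dist (blinfun_apply (f n) x) (blinfun_apply (f n) y) \<le> K * norm (x - y)"
        using Kx[of n "x - y"] by (simp add: dist_norm blinfun.diff_right)
      also have "\<dots> < K * (e / (4 * K))"
        using y(2) K(1) by (intro mult_strict_left_mono) (auto simp: dist_norm norm_minus_commute)
      finally show ?thesis using K(1) by simp
    qed
    obtain N where N: "\<And>m n. m \<ge> N \<Longrightarrow> n \<ge> N \<Longrightarrow>
        dist (blinfun_apply (f (r m)) y) (blinfun_apply (f (r n)) y) < e / 2"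
      using metric_CauchyD[OF conv_C[OF y(1)], of "e / 2"] e by auto
    show "\<exists>N. \<forall>m\<ge>N. \<forall>n\<ge>N. dist (blinfun_apply (f (r m)) x) (blinfun_apply (f (r n)) x) < e"
    proof (intro exI[of _ N] allI impI)
      fix m n assume "m \<ge> N" "n \<ge> N"
      from N[OF this] near[of "r m"] near[of "r n"]
        dist_triangle[of "blinfun_apply (f (r m)) x" "blinfun_apply (f (r n)) x" "blinfun_apply (f (r m)) y"]
        dist_triangle[of "blinfun_apply (f (r m)) y" "blinfun_apply (f (r n)) x" "blinfun_apply (f (r n)) y"]
      show "dist (blinfun_apply (f (r m)) x) (blinfun_apply (f (r n)) x) < e"
        using e by (simp add: dist_commute)
    qed
  qed
  then have "\<exists>l. (\<lambda>n. blinfun_apply (f (r n)) x) \<longlonglongrightarrow> l" for x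
    using convergent_eq_Cauchy by blast
  then obtain h where h: "\<And>x. (\<lambda>n. blinfun_apply (f (r n)) x) \<longlonglongrightarrow> h x"
    by metis
  have "bounded_linear h"
  proof (rule bounded_linear_intro)
    show "h (x + y) = h x + h y" for x y
      using tendsto_add[OF h h, of x y] h[of "x + y"]
      by (auto simp: blinfun.add_right intro: LIMSEQ_unique)
    show "h (c *\<^sub>R x) = c *\<^sub>R h x" for c x
      using tendsto_scaleR[OF tendsto_const h, of c x] h[of "c *\<^sub>R x"]
      by (auto simp: blinfun.scaleR_right intro: LIMSEQ_unique)
    show "norm (h x) \<le> norm x * K" for x
      using Kx by (intro LIMSEQ_le_const2[OF tendsto_norm[OF h]]) (auto simp: mult.commute)
  qed
  then show thesis
    using that[of r "Blinfun h"] r h by (simp add: bounded_linear_Blinfun_apply)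
qed

text \<open>A sequence in the closure is shadowed by terms \<open>f (m n)\<close> at distances
  tending to zero, but the indices \<open>m n\<close> come in no particular order. Either some index
  recurs infinitely often, giving a constant subsequence, or \<open>m\<close> has a strictly
  increasing subsequence, to which the assumption applies.\<close>

lemma compact_closure_range_if_subsequences_converge:
  fixes f :: "nat \<Rightarrow> 'a::metric_space"
  assumes sub: "\<And>m. strict_mono (m :: nat \<Rightarrow> nat) \<Longrightarrow>
    \<exists>l r. strict_mono (r :: nat \<Rightarrow> nat) \<and> (\<lambda>n. f (m (r n))) \<longlonglongrightarrow> l"
  shows "compact (closure (range f))"
proof -
  have range: "\<exists>l r. strict_mono (r :: nat \<Rightarrow> nat) \<and> (\<lambda>n. f (m (r n))) \<longlonglongrightarrow> l" for m :: "nat \<Rightarrow> nat"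
  proof (cases "\<exists>c. infinite {n. m n = c}")
    case True
    then obtain c where "infinite {n. m n = c}" by blast
    from infinite_enumerate[OF this] obtain r where "strict_mono (r :: nat \<Rightarrow> nat)" "\<And>n. m (r n) = c"
      by auto
    then show ?thesis by (intro exI[of _ "f c"] exI[of _ r]) simp
  next
    case False
    have "\<exists>r. \<forall>n. True \<and> r n < r (Suc n) \<and> m (r n) < m (r (Suc n))"
    proof (rule dependent_nat_choice)
      fix a n :: nat
      \<comment> \<open>Every index value is attained finitely often here, so only finitely many
        positions are unfit to follow \<open>a\<close>.\<close>
      have "{i. m i \<le> m a} = (\<Union>c\<le>m a. {i. m i = c})" by auto
      then have "finite ({..a} \<union> {i. m i \<le> m a})" using False by auto
      then obtain b where "b \<notin> {..a} \<union> {i. m i \<le> m a}"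
        using ex_new_if_finite[OF infinite_UNIV_nat] by blast
      then show "\<exists>b. True \<and> a < b \<and> m a < m b" by (intro exI[of _ b]) auto
    qed simp
    then obtain r where "\<And>n. r n < r (Suc n)" "\<And>n. m (r n) < m (r (Suc n))"
      by blast
    then have r: "strict_mono r" "strict_mono (\<lambda>n. m (r n))"
      by (simp_all add: strict_mono_Suc_iff)
    from sub[OF r(2)] obtain l r' where "strict_mono r'" "(\<lambda>n. f (m (r (r' n)))) \<longlonglongrightarrow> l"
      by blast
    with r(1) show ?thesis
      by (intro exI[of _ l] exI[of _ "\<lambda>n. r (r' n)"]) (auto simp: strict_mono_def)
  qed
  show ?thesis
    unfolding compact_eq_seq_compact_metric seq_compact_def
  proof (intro allI impI)
    fix c :: "nat \<Rightarrow> 'a" assume c: "\<forall>n. c n \<in> closure (range f)"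
    have "\<exists>k. dist (f k) (c n) < inverse (real (Suc n))" for n
      using c closure_approachable[of "c n" "range f"]
      by (metis inverse_positive_iff_positive of_nat_0_less_iff rangeE zero_less_Suc)
    then obtain m where m: "\<And>n. dist (f (m n)) (c n) < inverse (real (Suc n))" by metis
    have dist0: "(\<lambda>n. dist (f (m n)) (c n)) \<longlonglongrightarrow> 0"
      by (rule tendsto_sandwich[OF _ _ tendsto_const LIMSEQ_inverse_real_of_nat])
        (use m in \<open>auto intro!: always_eventually less_imp_le simp del: of_nat_Suc\<close>)
    obtain l r where r: "strict_mono r" and l: "(\<lambda>n. f (m (r n))) \<longlonglongrightarrow> l"
      using range by blast
    have "(c \<circ> r) \<longlonglongrightarrow> l"
    proof -
      have "(\<lambda>n. dist ((c \<circ> r) n) l) \<longlonglongrightarrow> 0"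
      proof (rule tendsto_sandwich[OF _ _ tendsto_const])
        show "\<forall>\<^sub>F n in sequentially. dist ((c \<circ> r) n) l
            \<le> dist (f (m (r n))) (c (r n)) + dist (f (m (r n))) l"
          by (simp add: dist_triangle3)
        show "(\<lambda>n. dist (f (m (r n))) (c (r n)) + dist (f (m (r n))) l) \<longlonglongrightarrow> 0"
          using tendsto_add[OF LIMSEQ_subseq_LIMSEQ[OF dist0 r] iffD1[OF tendsto_dist_iff l]]
          by (simp add: o_def)
      qed simp
      then show ?thesis by (rule iffD2[OF tendsto_dist_iff])
    qed
    moreover have "l \<in> closure (range f)"
      using l unfolding closure_sequential by (intro exI[of _ "\<lambda>n. f (m (r n))"]) auto
    ultimately show "\<exists>l\<in>closure (range f). \<exists>r. strict_mono r \<and> (c \<circ> r) \<longlonglongrightarrow> l"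
      using r by blast
  qed
qed

section \<open>Triangular systems of functionals and vectors\<close>

context banach_over
begin

lemma dual_scale: "f \<in> dual \<Longrightarrow> blinfun_apply f (scale c x) = c * blinfun_apply f x"
  by (simp add: dual_def)

lemma dual_diff: "f \<in> dual \<Longrightarrow> g \<in> dual \<Longrightarrow> f - g \<in> dual"
  by (simp add: dual_def blinfun.diff_left algebra_simps)

lemma subspace_ker: "f \<in> dual \<Longrightarrow> subspace {x. blinfun_apply f x = 0}"
  by (auto simp: subspace_def dual_scale blinfun.add_right)

text \<open>Vectors are added from the last index downwards: \<open>\<phi> a\<close> kills all later
  vectors but not \<open>y a\<close>, which therefore lies outside their span. The cardinality rules
  out repetitions, so that the dimension bound can be applied.\<close>

lemma triangular_independent:
  assumes dual: "\<And>i. \<phi> i \<in> dual"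
    and zero: "\<And>i l. i < l \<Longrightarrow> blinfun_apply (\<phi> i) (y l) = 0"
    and nonzero: "\<And>i. blinfun_apply (\<phi> i) (y i) \<noteq> 0"
  shows "independent (y ` {..<n}) \<and> card (y ` {..<n}) = n"
proof -
  have "a \<le> n \<Longrightarrow> independent (y ` {a..<n}) \<and> card (y ` {a..<n}) = n - a" for a
  proof (induction a rule: inc_induct)
    case base
    show ?case by (simp add: independent_empty)
  next
    case (step a)
    have "span (y ` {Suc a..<n}) \<subseteq> {x. blinfun_apply (\<phi> a) x = 0}"
      by (rule span_minimal) (auto simp: zero subspace_ker dual)
    then have new: "y a \<notin> span (y ` {Suc a..<n})"
      using nonzero[of a] by auto
    have "{a..<n} = insert a {Suc a..<n}"
      using step.hyps by auto
    then have eq: "y ` {a..<n} = insert (y a) (y ` {Suc a..<n})"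
      by simp
    have "y a \<notin> y ` {Suc a..<n}"
      using new span_base by blast
    then show ?case
      using step independent_insertI[OF new] unfolding eq by simp
  qed
  from this[of 0] show ?thesis by (simp add: lessThan_atLeast0)
qed

text \<open>The kernel of one functional has codimension at most one in \<open>W\<close>, so a
  single extra vector completes the spanning set. This later absorbs the passage from
  \<open>f\<close> to the differences with its limit.\<close>

lemma finite_dimensional_of_ker:
  assumes h: "h \<in> dual" and W: "subspace W"
    and B: "finite B" "W \<inter> {x. blinfun_apply h x = 0} \<subseteq> span B"
  obtains C where "finite C" "W \<subseteq> span C"
proof (cases "W \<subseteq> {x. blinfun_apply h x = 0}")
  case True
  with B show thesis by (intro that[of B]) auto
next
  case False
  then obtain w where w: "w \<in> W" "blinfun_apply h w \<noteq> 0" by auto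
  have "x \<in> span (insert w B)" if "x \<in> W" for x
  proof -
    define c where "c = blinfun_apply h x / blinfun_apply h w"
    have "x - scale c w \<in> W"
      using W w that by (simp add: subspace_diff subspace_scale)
    moreover have "blinfun_apply h (x - scale c w) = 0"
      using w by (simp add: blinfun.diff_right dual_scale[OF h] c_def)
    ultimately have "x - scale c w \<in> span B" using B by auto
    then show ?thesis
      by (auto simp: span_breakdown_eq)
  qed
  with B show thesis by (intro that[of "insert w B"]) auto
qed

text \<open>Forward elimination: subtracting a multiple of \<open>x n\<close> to satisfy the
  equation for \<open>\<phi> n\<close> leaves the earlier equations intact, since the earlier
  functionals vanish at \<open>x n\<close>. What matters is that \<open>D\<close> is independent of
  \<open>z\<close>, so the cost of the correction is known before \<open>z\<close> is
  chosen.\<close>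

lemma triangular_projection:
  fixes \<phi> :: "nat \<Rightarrow> 'a \<Rightarrow>\<^sub>L 'k"
  assumes dual: "\<And>i. i < n \<Longrightarrow> \<phi> i \<in> dual"
    and zero: "\<And>i j. i < j \<Longrightarrow> j < n \<Longrightarrow> blinfun_apply (\<phi> i) (x j) = 0"
    and one: "\<And>i. i < n \<Longrightarrow> blinfun_apply (\<phi> i) (x i) = 1"
  shows "\<exists>D\<ge>0. \<forall>z. \<exists>q. (\<forall>j<n. norm (q j) \<le> D * norm z) \<and>
           (\<forall>i<n. blinfun_apply (\<phi> i) (z - (\<Sum>j<n. scale (q j) (x j))) = 0)"
  using assms
proof (induction n)
  case 0
  show ?case by auto
next
  case (Suc n)
  have "\<exists>D\<ge>0. \<forall>z. \<exists>q. (\<forall>j<n. norm (q j) \<le> D * norm z) \<and>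
           (\<forall>i<n. blinfun_apply (\<phi> i) (z - (\<Sum>j<n. scale (q j) (x j))) = 0)"
    by (rule Suc.IH) (simp_all add: Suc.prems)
  then obtain D where D: "D \<ge> 0" and DD: "\<And>z. \<exists>q. (\<forall>j<n. norm (q j) \<le> D * norm z) \<and>
           (\<forall>i<n. blinfun_apply (\<phi> i) (z - (\<Sum>j<n. scale (q j) (x j))) = 0)"
    by blast
  \<comment> \<open>The second factor bounds the growth of \<open>z\<close> under the first
    \<open>n\<close> corrections, hence \<open>M\<close> bounds the new coefficient relative to
    \<open>norm z\<close>.\<close>
  define M where "M = norm (\<phi> n) * (1 + D * (\<Sum>j<n. norm (x j)))"
  show ?case
  proof (intro exI[of _ "max D M"] conjI allI)
    show "0 \<le> max D M" using D by simp
    fix z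
    obtain q where q: "\<And>j. j < n \<Longrightarrow> norm (q j) \<le> D * norm z"
      "\<And>i. i < n \<Longrightarrow> blinfun_apply (\<phi> i) (z - (\<Sum>j<n. scale (q j) (x j))) = 0"
      using DD[of z] by blast
    define w where "w = z - (\<Sum>j<n. scale (q j) (x j))"
    define q' where "q' = q(n := blinfun_apply (\<phi> n) w)"
    have "norm w \<le> norm z + (\<Sum>j<n. D * norm z * norm (x j))"
      unfolding w_def
      by (rule norm_triangle_le_diff add_left_mono sum_norm_le order_refl)+
        (auto simp: norm_scale intro: mult_right_mono q)
    also have "\<dots> = (1 + D * (\<Sum>j<n. norm (x j))) * norm z"
      by (simp add: algebra_simps sum_distrib_left)
    finally have "norm (\<phi> n) * norm w \<le> M * norm z"
      by (simp add: M_def mult.assoc mult_left_mono)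
    then have "norm (blinfun_apply (\<phi> n) w) \<le> M * norm z"
      using norm_blinfun[of "\<phi> n" w] by linarith
    then have "norm (q' j) \<le> max (D * norm z) (M * norm z)" if "j < Suc n" for j
      using q(1)[of j] that by (auto simp: q'_def less_Suc_eq le_max_iff_disj)
    then have 1: "\<forall>j<Suc n. norm (q' j) \<le> max D M * norm z"
      by (simp add: max_mult_distrib_right)
    have eq: "z - (\<Sum>j<Suc n. scale (q' j) (x j)) = w - scale (blinfun_apply (\<phi> n) w) (x n)"
      by (simp add: w_def q'_def)
    have 2: "\<forall>i<Suc n. blinfun_apply (\<phi> i) (z - (\<Sum>j<Suc n. scale (q' j) (x j))) = 0"
      unfolding eq using Suc.prems q(2)[folded w_def]
      by (auto simp: blinfun.diff_right dual_scale less_Suc_eq)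
    show "\<exists>q. (\<forall>j<Suc n. norm (q j) \<le> max D M * norm z) \<and>
           (\<forall>i<Suc n. blinfun_apply (\<phi> i) (z - (\<Sum>j<Suc n. scale (q j) (x j))) = 0)"
      by (rule exI[of _ q'], rule conjI[OF 1 2])
  qed
qed

section \<open>Correction by an infinite series\<close>

text \<open>The vector is \<open>x l\<close> minus a series in the \<open>x i\<close> with
  \<open>i \<in> E\<close> and \<open>l < i\<close>. As \<open>\<phi> i\<close> vanishes at all
  later vectors, its equation involves coefficients up to index \<open>i\<close> only and can be
  solved recursively. The coefficients grow at most like \<open>2^i\<close>, while the decay in
  \<open>small\<close> supplies \<open>(1/4)^i\<close>, so the series converges absolutely.\<close>

lemma triangular_annihilated:
  fixes \<phi> :: "nat \<Rightarrow> 'a \<Rightarrow>\<^sub>L 'k"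
  assumes dual: "\<And>i. \<phi> i \<in> dual"
    and zero: "\<And>i j. i < j \<Longrightarrow> blinfun_apply (\<phi> i) (x j) = 0"
    and one: "\<And>i. blinfun_apply (\<phi> i) (x i) = 1"
    and le1: "\<And>i j. j < i \<Longrightarrow> norm (blinfun_apply (\<phi> i) (x j)) \<le> 1"
    and small: "\<And>i j. j < i \<Longrightarrow> norm (blinfun_apply (\<phi> i) (x j)) * norm (x i) \<le> (1/4)^i"
    and l: "l \<notin> E"
  obtains y where "\<And>i. i \<in> E \<Longrightarrow> blinfun_apply (\<phi> i) y = 0"
    "\<And>i. i < l \<Longrightarrow> blinfun_apply (\<phi> i) y = 0" "blinfun_apply (\<phi> l) y = 1"
proof -
  \<comment> \<open>Since \<open>\<phi> i\<close> is 1 at \<open>x i\<close>, this value of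
    \<open>c i\<close> is exactly what cancels the remainder under \<open>\<phi> i\<close>. The
    default 0 lets all sums run over an initial segment.\<close>
  have "\<exists>c. \<forall>i. c i = (if i \<in> E \<and> l < i
      then blinfun_apply (\<phi> i) (x l - (\<Sum>j<i. scale (c j) (x j))) else 0)"
  proof (rule dependent_wellorder_choice)
    fix r :: 'k and p q :: "nat \<Rightarrow> 'k" and i :: nat
    assume "\<And>j. j < i \<Longrightarrow> p j = q j"
    then have "(\<Sum>j<i. scale (p j) (x j)) = (\<Sum>j<i. scale (q j) (x j))"
      by (intro sum.cong) auto
    then show "(r = (if i \<in> E \<and> l < i
          then blinfun_apply (\<phi> i) (x l - (\<Sum>j<i. scale (p j) (x j))) else 0)) =
        (r = (if i \<in> E \<and> l < i
          then blinfun_apply (\<phi> i) (x l - (\<Sum>j<i. scale (q j) (x j))) else 0))"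
      by simp
  qed blast
  then obtain c where c: "\<And>i. c i = (if i \<in> E \<and> l < i
      then blinfun_apply (\<phi> i) (x l - (\<Sum>j<i. scale (c j) (x j))) else 0)"
    by blast
  \<comment> \<open>The leading 1 accounts for the coefficient of \<open>x l\<close> itself.\<close>
  define s where "s i = 1 + (\<Sum>j<i. norm (c j))" for i
  \<comment> \<open>The weight \<open>t\<close> stays free because the estimate is used twice:
    \<open>t = 1\<close> and \<open>d = 1\<close> show that \<open>s\<close> at most doubles at each
    step, and \<open>t = norm (x i)\<close> with \<open>d = (1/4)^i\<close> bounds the terms of the
    series.\<close>
  have c_le: "norm (c i) * t \<le> s i * d"
    if "t \<ge> 0" "d \<ge> 0" and d: "\<And>j. j < i \<Longrightarrow> norm (blinfun_apply (\<phi> i) (x j)) * t \<le> d" for i t d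
  proof (cases "i \<in> E \<and> l < i")
    case True
    have "norm (c i) = norm (blinfun_apply (\<phi> i) (x l) - (\<Sum>j<i. c j * blinfun_apply (\<phi> i) (x j)))"
      using True by (subst c) (simp add: blinfun.diff_right blinfun.sum_right dual_scale[OF dual])
    also have "\<dots> \<le> norm (blinfun_apply (\<phi> i) (x l))
        + (\<Sum>j<i. norm (c j) * norm (blinfun_apply (\<phi> i) (x j)))"
      by (rule norm_triangle_le_diff add_left_mono sum_norm_le order_refl)+ (simp add: norm_mult)
    finally have "norm (c i) * t \<le> (norm (blinfun_apply (\<phi> i) (x l))
        + (\<Sum>j<i. norm (c j) * norm (blinfun_apply (\<phi> i) (x j)))) * t"
      using that by (intro mult_right_mono)
    also have "\<dots> = norm (blinfun_apply (\<phi> i) (x l)) * t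
        + (\<Sum>j<i. norm (c j) * (norm (blinfun_apply (\<phi> i) (x j)) * t))"
      by (simp add: algebra_simps sum_distrib_left)
    also have "\<dots> \<le> d + (\<Sum>j<i. norm (c j) * d)"
      using True d by (intro add_mono sum_mono mult_left_mono) auto
    finally show ?thesis
      by (simp add: s_def algebra_simps sum_distrib_left)
  next
    case False
    then have "c i = 0" using c[of i] by argo
    then show ?thesis using that
      by (auto simp: s_def intro!: mult_nonneg_nonneg add_nonneg_nonneg sum_nonneg)
  qed
  have s_le: "s i \<le> 2 ^ i" for i
  proof (induction i)
    case (Suc i)
    have "norm (c i) \<le> s i"
      using c_le[of 1 1 i] le1 by simp
    then show ?case
      using Suc by (simp add: s_def)
  qed (simp add: s_def)
  have "norm (scale (c i) (x i)) \<le> (1/2)^i" for i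
  proof -
    have "norm (scale (c i) (x i)) \<le> s i * (1/4)^i"
      using c_le[of "norm (x i)" "(1/4)^i" i] small by (simp add: norm_scale)
    also have "\<dots> \<le> 2^i * (1/4)^i"
      using s_le by (intro mult_right_mono) auto
    also have "\<dots> = (1/2)^i"
      by (simp flip: power_mult_distrib)
    finally show ?thesis .
  qed
  then have summable: "summable (\<lambda>i. scale (c i) (x i))"
    by (intro summable_comparison_test'[OF summable_geometric[of "1/2::real"], of 0]) auto
  define y where "y = x l - (\<Sum>i. scale (c i) (x i))"
  \<comment> \<open>Under \<open>\<phi> a\<close> the series stops at index \<open>a\<close>, and
    its last term contributes just \<open>c a\<close>. For \<open>a \<in> E\<close> beyond
    \<open>l\<close> the recursion makes the difference zero; up to \<open>l\<close> all
    coefficients vanish and only \<open>x l\<close> is seen.\<close>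
  have y: "blinfun_apply (\<phi> a) y
      = blinfun_apply (\<phi> a) (x l - (\<Sum>i<a. scale (c i) (x i))) - c a" for a
  proof -
    have "blinfun_apply (\<phi> a) (\<Sum>i. scale (c i) (x i)) = (\<Sum>i. blinfun_apply (\<phi> a) (scale (c i) (x i)))"
      by (rule bounded_linear.suminf[OF blinfun.bounded_linear_right summable])
    also have "\<dots> = (\<Sum>i<Suc a. blinfun_apply (\<phi> a) (scale (c i) (x i)))"
      by (rule suminf_finite) (auto simp: dual_scale[OF dual] zero)
    finally show ?thesis
      by (simp add: y_def blinfun.diff_right blinfun.sum_right dual_scale[OF dual] one)
  qed
  have c0: "c i = 0" if "i \<le> l \<or> i \<notin> E" for i
    using that c[of i] by (metis not_less)
  have y_le: "blinfun_apply (\<phi> a) y = blinfun_apply (\<phi> a) (x l)" if "a \<le> l" for a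
    using that c0 by (simp add: y)
  show thesis
  proof (rule that)
    show "blinfun_apply (\<phi> i) y = 0" if "i < l" for i
      using that by (simp add: y_le zero)
    show "blinfun_apply (\<phi> l) y = 1"
      by (simp add: y_le one)
    show "blinfun_apply (\<phi> i) y = 0" if "i \<in> E" for i
    proof (cases "l < i")
      case True
      with that c[of i] show ?thesis by (simp add: y)
    next
      case False
      with that l have "i < l" by (metis linorder_neqE_nat)
      then show ?thesis by (simp add: y_le zero)
    qed
  qed
qed

section \<open>Gliding hump construction\<close>

text \<open>A vector \<open>v\<close> nearly norming \<open>g m\<close> is projected into the common
  kernel of the earlier functionals. For late \<open>m\<close> the earlier vectors are almost killed
  by \<open>g m\<close>, so the projection costs little of the value at \<open>v\<close>. After
  normalisation the norm is at most \<open>4 * M / \<delta>\<close>, a bound independent of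
  \<open>m\<close>, so \<open>m\<close> can be chosen with that bound in view.\<close>

lemma gliding_hump_step:
  fixes g :: "nat \<Rightarrow> 'a \<Rightarrow>\<^sub>L 'k" and k :: "nat \<Rightarrow> nat"
  assumes dual: "\<And>n. g n \<in> dual"
    and null: "\<And>x. (\<lambda>n. blinfun_apply (g n) x) \<longlonglongrightarrow> 0"
    and \<delta>: "\<delta> > 0" "\<And>n. norm (g n) \<ge> \<delta>"
    and zero: "\<And>i j. i < j \<Longrightarrow> j < n \<Longrightarrow> blinfun_apply (g (k i)) (x j) = 0"
    and one: "\<And>i. i < n \<Longrightarrow> blinfun_apply (g (k i)) (x i) = 1"
    and \<epsilon>: "\<epsilon> > 0"
  shows "\<exists>m z. (\<forall>i<n. k i < m) \<and> (\<forall>i<n. blinfun_apply (g (k i)) z = 0) \<and>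
      blinfun_apply (g m) z = 1 \<and> (\<forall>j<n. norm (blinfun_apply (g m) (x j)) \<le> 1) \<and>
      (\<forall>j<n. norm (blinfun_apply (g m) (x j)) * norm z \<le> \<epsilon>)"
proof -
  obtain D where D: "D \<ge> 0" and DD: "\<And>z. \<exists>q. (\<forall>j<n. norm (q j) \<le> D * norm z) \<and>
           (\<forall>i<n. blinfun_apply (g (k i)) (z - (\<Sum>j<n. scale (q j) (x j))) = 0)"
    using triangular_projection[of n "\<lambda>i. g (k i)" x] dual zero one by blast
  define M where "M = 1 + D * (\<Sum>j<n. norm (x j))"
  have M: "M > 0" using D by (auto simp: M_def intro!: add_pos_nonneg mult_nonneg_nonneg sum_nonneg)
  have nn: "(\<lambda>m. norm (blinfun_apply (g m) (x j))) \<longlonglongrightarrow> 0" for j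
    using tendsto_norm_zero[OF null] .
  have "\<forall>\<^sub>F m in sequentially. \<forall>i\<in>{..<n}. k i < m"
    by (intro eventually_ball_finite) (auto intro: eventually_gt_at_top)
  moreover have "\<forall>\<^sub>F m in sequentially. \<forall>j\<in>{..<n}. norm (blinfun_apply (g m) (x j)) < 1"
    by (intro eventually_ball_finite ballI order_tendstoD(2)[OF nn]) auto
  \<comment> \<open>The divisor \<open>4 * M / \<delta>\<close> anticipates the bound
    \<open>z_le\<close> on the vector still to be built.\<close>
  moreover have "\<forall>\<^sub>F m in sequentially. \<forall>j\<in>{..<n}.
      norm (blinfun_apply (g m) (x j)) < \<epsilon> / (4 * M / \<delta>)"
    using \<epsilon> \<delta> M by (intro eventually_ball_finite ballI order_tendstoD(2)[OF nn]) auto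
  \<comment> \<open>This quantity times \<open>norm v\<close> bounds the effect of the projection
    under \<open>g m\<close>. Keeping it below \<open>\<delta> / 4\<close> preserves half of the
    value \<open>\<delta> / 2\<close> secured at \<open>v\<close>.\<close>
  moreover have "(\<lambda>m. D * (\<Sum>j<n. norm (blinfun_apply (g m) (x j)))) \<longlonglongrightarrow> D * (\<Sum>j<n. 0)"
    by (intro tendsto_intros nn)
  then have "\<forall>\<^sub>F m in sequentially. D * (\<Sum>j<n. norm (blinfun_apply (g m) (x j))) < \<delta> / 4"
    by (rule order_tendstoD) (use \<delta> in simp)
  ultimately have "\<forall>\<^sub>F m in sequentially. (\<forall>i\<in>{..<n}. k i < m) \<and>
      (\<forall>j\<in>{..<n}. norm (blinfun_apply (g m) (x j)) < 1) \<and>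
      (\<forall>j\<in>{..<n}. norm (blinfun_apply (g m) (x j)) < \<epsilon> / (4 * M / \<delta>)) \<and>
      D * (\<Sum>j<n. norm (blinfun_apply (g m) (x j))) < \<delta> / 4"
    by (intro eventually_conj)
  then obtain m where m: "\<And>i. i < n \<Longrightarrow> k i < m"
    "\<And>j. j < n \<Longrightarrow> norm (blinfun_apply (g m) (x j)) < 1"
    "\<And>j. j < n \<Longrightarrow> norm (blinfun_apply (g m) (x j)) < \<epsilon> / (4 * M / \<delta>)"
    "D * (\<Sum>j<n. norm (blinfun_apply (g m) (x j))) < \<delta> / 4"
    unfolding eventually_sequentially by blast
  obtain v where v: "norm (blinfun_apply (g m) v) > \<delta> / 2 * norm v"
  proof (rule ccontr)
    assume "\<not> thesis"
    then have "norm (g m) \<le> \<delta> / 2"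
      using \<delta>(1) that by (intro norm_blinfun_bound) (auto simp: not_less[symmetric])
    with \<delta>(1) \<delta>(2)[of m] show False by simp
  qed
  have v0: "norm v > 0" using v by auto
  obtain q where q: "\<And>j. j < n \<Longrightarrow> norm (q j) \<le> D * norm v"
      "\<And>i. i < n \<Longrightarrow> blinfun_apply (g (k i)) (v - (\<Sum>j<n. scale (q j) (x j))) = 0"
    using DD[of v] by blast
  define w where "w = v - (\<Sum>j<n. scale (q j) (x j))"
  have "norm w \<le> norm v + (\<Sum>j<n. D * norm v * norm (x j))"
    unfolding w_def
    by (rule norm_triangle_le_diff add_left_mono sum_norm_le order_refl)+
      (auto simp: norm_scale intro: mult_right_mono q)
  also have "\<dots> = M * norm v"
    by (simp add: M_def algebra_simps sum_distrib_left)
  finally have w_le: "norm w \<le> M * norm v" .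
  have "norm (\<Sum>j<n. q j * blinfun_apply (g m) (x j))
      \<le> (\<Sum>j<n. D * norm v * norm (blinfun_apply (g m) (x j)))"
    by (rule sum_norm_le) (auto simp: norm_mult intro: mult_right_mono q)
  also have "\<dots> = D * (\<Sum>j<n. norm (blinfun_apply (g m) (x j))) * norm v"
    by (simp add: algebra_simps sum_distrib_left)
  also have "\<dots> \<le> \<delta> / 4 * norm v"
    using m(4) by (intro mult_right_mono) auto
  finally have gw: "norm (blinfun_apply (g m) w) \<ge> \<delta> / 4 * norm v"
    using v norm_triangle_ineq2[of "blinfun_apply (g m) v" "\<Sum>j<n. q j * blinfun_apply (g m) (x j)"]
    by (simp add: w_def blinfun.diff_right blinfun.sum_right dual_scale[OF dual])
  then have gw0: "norm (blinfun_apply (g m) w) > 0"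
    using \<delta>(1) v0 by (smt (verit) mult_pos_pos zero_less_divide_iff)
  define z where "z = scale (inverse (blinfun_apply (g m) w)) w"
  have "norm z = norm w / norm (blinfun_apply (g m) w)"
    by (simp add: z_def norm_scale norm_inverse divide_inverse)
  also have "\<dots> \<le> (M * norm v) / (\<delta> / 4 * norm v)"
    using w_le gw gw0 M \<delta>(1) v0 by (intro frac_le) auto
  also have "\<dots> = 4 * M / \<delta>"
    using v0 by simp
  finally have z_le: "norm z \<le> 4 * M / \<delta>" .
  show ?thesis
  proof (intro exI[of _ m] exI[of _ z] conjI allI impI)
    fix i assume i: "i < n"
    show "k i < m" "norm (blinfun_apply (g m) (x i)) \<le> 1"
      using m i by (auto intro: less_imp_le)
    show "blinfun_apply (g (k i)) z = 0"
      using q(2)[OF i] by (simp add: z_def w_def dual_scale[OF dual])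
    have "norm (blinfun_apply (g m) (x i)) * norm z \<le> \<epsilon> / (4 * M / \<delta>) * (4 * M / \<delta>)"
      using m(3)[OF i] z_le \<epsilon> M \<delta>(1) by (intro mult_mono) auto
    then show "norm (blinfun_apply (g m) (x i)) * norm z \<le> \<epsilon>"
      using M \<delta>(1) by simp
  next
    show "blinfun_apply (g m) z = 1"
      using gw0 by (simp add: z_def dual_scale[OF dual])
  qed
qed

text \<open>The single step is iterated with tolerance \<open>(1/4)^n\<close> at stage
  \<open>n\<close>, the decay that beats the doubling of coefficients in
  \<open>triangular_annihilated\<close>.\<close>

lemma gliding_hump:
  fixes g :: "nat \<Rightarrow> 'a \<Rightarrow>\<^sub>L 'k"
  assumes dual: "\<And>n. g n \<in> dual"
    and null: "\<And>x. (\<lambda>n. blinfun_apply (g n) x) \<longlonglongrightarrow> 0"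
    and \<delta>: "\<delta> > 0" "\<And>n. norm (g n) \<ge> \<delta>"
  obtains k x where "strict_mono k"
    "\<And>i j. i < j \<Longrightarrow> blinfun_apply (g (k i)) (x j) = 0"
    "\<And>i. blinfun_apply (g (k i)) (x i) = 1"
    "\<And>i j. j < i \<Longrightarrow> norm (blinfun_apply (g (k i)) (x j)) \<le> 1"
    "\<And>i j. j < i \<Longrightarrow> norm (blinfun_apply (g (k i)) (x j)) * norm (x i) \<le> (1/4)^i"
proof -
  \<comment> \<open>A stage is a pair of a functional's index and a vector; \<open>P p n r\<close>
    declares \<open>r\<close> admissible after the stages of \<open>p\<close> below
    \<open>n\<close>, the only ones it reads, as the recursive choice requires.\<close>
  define P where "P p n r \<longleftrightarrow> (\<forall>i<n. fst (p i) < fst r) \<and>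
      (\<forall>i<n. blinfun_apply (g (fst (p i))) (snd r) = 0) \<and> blinfun_apply (g (fst r)) (snd r) = 1 \<and>
      (\<forall>j<n. norm (blinfun_apply (g (fst r)) (snd (p j))) \<le> 1) \<and>
      (\<forall>j<n. norm (blinfun_apply (g (fst r)) (snd (p j))) * norm (snd r) \<le> (1/4)^n)"
    for p :: "nat \<Rightarrow> nat \<times> 'a" and n r
  have "\<exists>p. \<forall>n. P p n (p n)"
  proof (rule dependent_wellorder_choice)
    show "P p n r = P q n r" if "\<And>i. i < n \<Longrightarrow> p i = q i" for p q r and n :: nat
      using that by (simp add: P_def)
    show "\<exists>r. P p n r" if IH: "\<And>i. i < n \<Longrightarrow> P p i (p i)" for p and n :: nat
    proof -
      have "\<exists>m z. (\<forall>i<n. fst (p i) < m) \<and> (\<forall>i<n. blinfun_apply (g (fst (p i))) z = 0) \<and>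
          blinfun_apply (g m) z = 1 \<and> (\<forall>j<n. norm (blinfun_apply (g m) (snd (p j))) \<le> 1) \<and>
          (\<forall>j<n. norm (blinfun_apply (g m) (snd (p j))) * norm z \<le> (1/4)^n)"
        by (rule gliding_hump_step[OF dual null \<delta>]) (use IH in \<open>auto simp: P_def\<close>)
      then show ?thesis by (simp add: P_def)
    qed
  qed
  then obtain p where p: "\<And>n. P p n (p n)" by blast
  show thesis
    by (rule that[of "fst \<circ> p" "snd \<circ> p"]) (use p in \<open>auto simp: P_def strict_mono_def\<close>)
qed

section \<open>Infinite-dimensional annihilators and the contradiction\<close>

text \<open>The even functionals of the hump are annihilated by one corrected vector for each odd
  index, and the odd functionals are triangular on these vectors. Hence the annihilator contains
  independent families of every finite size.\<close>

lemma infinite_dimensional_annihilator: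
  fixes g :: "nat \<Rightarrow> 'a \<Rightarrow>\<^sub>L 'k"
  assumes dual: "\<And>n. g n \<in> dual"
    and null: "\<And>x. (\<lambda>n. blinfun_apply (g n) x) \<longlonglongrightarrow> 0"
    and \<delta>: "\<delta> > 0" "\<And>n. norm (g n) \<ge> \<delta>"
  obtains r :: "nat \<Rightarrow> nat" where "strict_mono r"
    "\<And>B. finite B \<Longrightarrow> \<not> {x. \<forall>n. blinfun_apply (g (r n)) x = 0} \<subseteq> span B"
proof -
  obtain k x where k: "strict_mono k"
    and kx: "\<And>i j. i < j \<Longrightarrow> blinfun_apply (g (k i)) (x j) = 0"
      "\<And>i. blinfun_apply (g (k i)) (x i) = 1"
      "\<And>i j. j < i \<Longrightarrow> norm (blinfun_apply (g (k i)) (x j)) \<le> 1"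
      "\<And>i j. j < i \<Longrightarrow> norm (blinfun_apply (g (k i)) (x j)) * norm (x i) \<le> (1/4)^i"
    using gliding_hump[OF dual null \<delta>] by blast
  have "\<exists>y. (\<forall>n. blinfun_apply (g (k (2 * n))) y = 0) \<and>
      (\<forall>i<2 * l + 1. blinfun_apply (g (k i)) y = 0) \<and> blinfun_apply (g (k (2 * l + 1))) y = 1" for l
  proof -
    have "2 * l + 1 \<notin> range (\<lambda>n::nat. 2 * n)" by (auto, presburger)
    from triangular_annihilated[of "\<lambda>i. g (k i)" x, OF dual kx this]
    show ?thesis by (metis rangeI)
  qed
  then obtain y where y: "\<And>l n. blinfun_apply (g (k (2 * n))) (y l) = 0"
      "\<And>l i. i < 2 * l + 1 \<Longrightarrow> blinfun_apply (g (k i)) (y l) = 0"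
      "\<And>l. blinfun_apply (g (k (2 * l + 1))) (y l) = 1"
    by metis
  show thesis
  proof (rule that[of "\<lambda>n. k (2 * n)"])
    show "strict_mono (\<lambda>n. k (2 * n))"
      using k by (simp add: strict_mono_def)
    fix B :: "'a set" assume B: "finite B"
    have "independent (y ` {..<n}) \<and> card (y ` {..<n}) = n" for n
      by (rule triangular_independent[of "\<lambda>i. g (k (2 * i + 1))"]) (simp_all add: dual y[simplified])
    then have "\<not> y ` {..<Suc (card B)} \<subseteq> span B"
      using independent_span_bound[OF B] by (metis Suc_n_not_le_n)
    moreover have "y ` {..<Suc (card B)} \<subseteq> {x. \<forall>n. blinfun_apply (g (k (2 * n))) x = 0}"
      using y(1) by auto
    ultimately show "\<not> {x. \<forall>n. blinfun_apply (g (k (2 * n))) x = 0} \<subseteq> span B"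
      by blast
  qed
qed

text \<open>If norm convergence fails, the differences with the pointwise limit \<open>h\<close>
  have an infinite-dimensional annihilator along a subsequence, and intersecting with the kernel of
  \<open>h\<close> lands in an annihilator of a subsequence of \<open>f\<close>.\<close>

lemma almost_overtotal_convergent_subsequence:
  fixes f :: "nat \<Rightarrow> 'a \<Rightarrow>\<^sub>L 'k"
  assumes sep: "separable_space (euclidean :: 'a topology)"
    and dual: "\<And>n. f n \<in> dual" and bdd: "bounded (range f)" and ot: "almost_overtotal f"
    and m: "strict_mono (m :: nat \<Rightarrow> nat)"
  shows "\<exists>l r. strict_mono (r :: nat \<Rightarrow> nat) \<and> (\<lambda>n. f (m (r n))) \<longlonglongrightarrow> l"
proof (rule ccontr)
  assume no: "\<not> ?thesis"
  have "bounded (range (\<lambda>n. f (m n)))"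
    by (rule bounded_subset[OF bdd]) auto
  then obtain r h where r: "strict_mono r"
    and h: "\<And>x. (\<lambda>n. blinfun_apply (f (m (r n))) x) \<longlonglongrightarrow> blinfun_apply h x"
    using pointwise_convergent_subsequence[OF sep, of "\<lambda>n. f (m n)"] by metis
  \<comment> \<open>The type of \<open>h\<close> records linearity over the reals only; homogeneity
    over \<open>'k\<close> has to pass to the limit separately.\<close>
  have h_dual: "h \<in> dual"
    unfolding dual_def
  proof (intro CollectI allI)
    fix c x
    show "blinfun_apply h (scale c x) = c * blinfun_apply h x"
      using h[of "scale c x"] tendsto_mult[OF tendsto_const h, of c x]
      by (auto simp: dual_scale[OF dual] intro: LIMSEQ_unique)
  qed
  have "\<not> (\<lambda>n. f (m (r n))) \<longlonglongrightarrow> h"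
    using no r by blast
  then obtain \<delta> where \<delta>: "\<delta> > 0" and "\<And>N. \<exists>n\<ge>N. norm (f (m (r n)) - h) \<ge> \<delta>"
    unfolding LIMSEQ_def dist_norm by (metis not_less)
  then have "infinite {n. norm (f (m (r n)) - h) \<ge> \<delta>}"
    by (auto simp: infinite_nat_iff_unbounded_le)
  from infinite_enumerate[OF this, unfolded mem_Collect_eq]
  obtain r' :: "nat \<Rightarrow> nat" where r': "strict_mono r'" "\<And>n. norm (f (m (r (r' n))) - h) \<ge> \<delta>"
    by blast
  define g where "g n = f (m (r (r' n))) - h" for n
  have g_null: "(\<lambda>n. blinfun_apply (g n) x) \<longlonglongrightarrow> 0" for x
    using LIM_zero[OF LIMSEQ_subseq_LIMSEQ[OF h r'(1)], of x]
    by (simp add: g_def blinfun.diff_left o_def)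
  have g_dual: "g n \<in> dual" for n
    by (simp add: g_def dual_diff dual h_dual)
  obtain s :: "nat \<Rightarrow> nat" where s: "strict_mono s"
    and inf: "\<And>B. finite B \<Longrightarrow> \<not> {x. \<forall>n. blinfun_apply (g (s n)) x = 0} \<subseteq> span B"
    using infinite_dimensional_annihilator[OF g_dual g_null \<delta> r'(2)[folded g_def]] by blast
  define W where "W = {x. \<forall>n. blinfun_apply (g (s n)) x = 0}"
  have W: "subspace W"
    by (auto simp: W_def subspace_def dual_scale[OF g_dual] blinfun.add_right)
  have "strict_mono (\<lambda>n. m (r (r' (s n))))"
    using m r r'(1) s by (simp add: strict_mono_def)
  with ot obtain B where B: "finite B"
    "span B = {x. \<forall>n. blinfun_apply (f (m (r (r' (s n))))) x = 0}"
    unfolding almost_overtotal_def finite_dimensional_def by blast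
  \<comment> \<open>Where \<open>h\<close> vanishes, \<open>g (s n)\<close> agrees with the
    corresponding term of \<open>f\<close>, so both have the same zeros there.\<close>
  have "W \<inter> {x. blinfun_apply h x = 0} \<subseteq> span B"
    by (auto simp: B(2) W_def g_def blinfun.diff_left)
  from finite_dimensional_of_ker[OF h_dual W B(1) this] show False
    using inf unfolding W_def by blast
qed

end

theorem theorem2p3:
  fixes scale :: "'k :: {real_normed_field, heine_borel} \<Rightarrow> 'a :: banach \<Rightarrow> 'a"
    and f :: "nat \<Rightarrow> 'a \<Rightarrow>\<^sub>L 'k"
  assumes "banach_over scale"
    and "separable_space (euclidean :: 'a topology)"
    and "\<And>n. f n \<in> banach_over.dual scale"
    and "bounded (range f)"
    and "banach_over.almost_overtotal scale f"
  shows "compact (closure (range f))"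
  using banach_over.almost_overtotal_convergent_subsequence[OF assms]
  by (rule compact_closure_range_if_subsequences_converge)

end
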